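(* Assume that $\operatorname{char} k=0$. Let $H_t(z)\in k[[t]]\langle\langle z\rangle\rangle^{\times n}$ with $o(H_t(z))\ge 2$, let $F_t(z)=z-H_t(z)$, let $G_t(z)$ be the inverse map of $F_t(z)$, and let $M_t(z)=G_t(z)-z$. Put $h(t)=\left[\frac{\partial M_t}{\partial t}(F_t)\frac{\partial}{\partial z}\right]$ and $m(t)=\left[\frac{\partial H_t}{\partial t}(G_t)\frac{\partial}{\partial z}\right]$. Then: (a) For any $U_t(z)\in k[[t]]\langle\langle z\rangle\rangle$, one has $U_t(z)=u(F_t(z))$ for some $u(z)\in k\langle\langle z\rangle\rangle$ if and only if $U_t(z)$ satisfies $$\frac{\partial U_t(z)}{\partial t}=-h(t)\,U_t(z).$$ (b) For any $V_t(z)\in k[[t]]\langle\langle z\rangle\rangle$, one has $V_t(z)=u(G_t(z))$ for some $u(z)\in k\langle\langle z\rangle\rangle$ if and only if $V_t(z)$ satisfies $$\frac{\partial V_t(z)}{\partial t}=m(t)\,V_t(z).$$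
   Context: $k$ is a (commutative) unital integral domain; $n\ge 1$; $z=(z_1,\dots,z_n)$ are noncommutative free variables; $t$ is a formal parameter commuting with $z$. $k\langle\langle z\rangle\rangle$ and $k[[t]]\langle\langle z\rangle\rangle$ are the algebras of formal power series in the noncommuting variables $z_i$ over $k$ and $k[[t]]$. The order $o(U)$ of a vector $U$ is the minimum of the orders (lowest degree in $z$; $t$ counts as a scalar) of its components. An automorphism of $k[[t]]\langle\langle z\rangle\rangle$ over $k[[t]]$ is identified with the vector $F_t=(F_{t,1},\dots,F_{t,n})$ of images of $z_1,\dots,z_n$, and $u(F_t)$ denotes the image of $u$, i.e. the result of substituting $F_{t,i}$ for $z_i$; for vectors this is done componentwise. If $o(H_t)\ge 2$, then $z-H_t$ is an automorphism; its inverse map $G_t$ satisfies $F_t(G_t(z))=z=G_t(F_t(z))$. For a vector $\vec u=(u_1,\dots,u_n)$ over $k[[t]]\langle\langle z\rangle\rangle$, $[\vec u\frac{\partial}{\partial z}]$ denotes the unique $k[[t]]$-derivation of $k[[t]]\langle\langle z\rangle\rangle$ sending $z_i$ to $u_i$ for all $i$. $\frac{\partial}{\partial t}$ is the derivation of $k[[t]]\langle\langle z\rangle\rangle$ extending $\frac{\partial}{\partial t}$ on $k[[t]]$ coefficientwise, with $\frac{\partial z_i}{\partial t}=0$; it acts on vectors componentwise. *)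

theory Defs
  imports
    "HOL-Computational_Algebra.Formal_Power_Series"
    "HOL-Analysis.Finite_Cartesian_Product"
    "HOL-Library.Extended_Nat"
begin

unbundle no fps_syntax

section \<open>Formal power series in noncommuting variables\<close>

text \<open>
  A series in the noncommuting variables \<open>z\<^sub>i\<close>, \<open>i :: 'n\<close>, is the family of the coefficients of
  its monomials; the word \<open>[i\<^sub>1, \<dots>, i\<^sub>m]\<close> stands for \<open>z\<^bsub>i\<^sub>1\<^esub> \<cdots> z\<^bsub>i\<^sub>m\<^esub>\<close>.
\<close>

typedef ('a, 'n) nc_fps = "UNIV :: ('n list \<Rightarrow> 'a) set"
  morphisms nc_nth Abs_nc_fps ..

setup_lifting type_definition_nc_fps

lemma nc_fps_eqI: "(\<And>w. nc_nth f w = nc_nth g w) \<Longrightarrow> f = g"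
  by transfer auto

definition splits :: "'n list \<Rightarrow> ('n list \<times> 'n list) set" where
  "splits w = {(p, q). p @ q = w}"

lemma splits_Nil [simp]: "splits [] = {([], [])}"
  by (auto simp: splits_def)

lemma splits_Cons: "splits (x # w) = insert ([], x # w) (apfst ((#) x) ` splits w)"
  by (auto simp: splits_def Cons_eq_append_conv append_eq_Cons_conv image_iff)

lemma finite_splits [simp]: "finite (splits w)"
  by (induction w) (auto simp: splits_Cons)

instantiation nc_fps :: (ring_1, type) ring_1
begin

lift_definition zero_nc_fps :: "('a, 'b) nc_fps" is "\<lambda>_. 0" .
lift_definition one_nc_fps :: "('a, 'b) nc_fps" is "\<lambda>w. if w = [] then 1 else 0" .
lift_definition plus_nc_fps :: "('a, 'b) nc_fps \<Rightarrow> ('a, 'b) nc_fps \<Rightarrow> ('a, 'b) nc_fps"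
  is "\<lambda>f g w. f w + g w" .
lift_definition minus_nc_fps :: "('a, 'b) nc_fps \<Rightarrow> ('a, 'b) nc_fps \<Rightarrow> ('a, 'b) nc_fps"
  is "\<lambda>f g w. f w - g w" .
lift_definition uminus_nc_fps :: "('a, 'b) nc_fps \<Rightarrow> ('a, 'b) nc_fps"
  is "\<lambda>f w. - f w" .
lift_definition times_nc_fps :: "('a, 'b) nc_fps \<Rightarrow> ('a, 'b) nc_fps \<Rightarrow> ('a, 'b) nc_fps"
  is "\<lambda>f g w. \<Sum>(p, q)\<in>splits w. f p * g q" .

instance
proof
  fix a b c :: "('a, 'b) nc_fps"
  show "a * b * c = a * (b * c)"
  proof (transfer, rule ext)
    fix a b c :: "'b list \<Rightarrow> 'a" and w
    have "(\<Sum>(p, q)\<in>splits w. (\<Sum>(r, s)\<in>splits p. a r * b s) * c q)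
        = (\<Sum>((p, q), (r, s))\<in>Sigma (splits w) (\<lambda>(p, q). splits p). a r * b s * c q)"
      by (simp add: sum.Sigma sum_distrib_right case_prod_unfold)
    also have "\<dots> = (\<Sum>((p, q), (r, s))\<in>Sigma (splits w) (\<lambda>(p, q). splits q). a p * (b r * c s))"
      by (rule sum.reindex_bij_witness
            [where i = "\<lambda>((p, q), (r, s)). ((p @ r, s), (p, r))"
               and j = "\<lambda>((p, q), (r, s)). ((r, s @ q), (s, q))"])
         (auto simp: splits_def mult.assoc)
    also have "\<dots> = (\<Sum>(p, q)\<in>splits w. a p * (\<Sum>(r, s)\<in>splits q. b r * c s))"
      by (simp add: sum.Sigma sum_distrib_left case_prod_unfold)
    finally show "(\<Sum>(p, q)\<in>splits w. (\<Sum>(r, s)\<in>splits p. a r * b s) * c q)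
        = (\<Sum>(p, q)\<in>splits w. a p * (\<Sum>(r, s)\<in>splits q. b r * c s))" .
  qed
  show "1 * a = a"
  proof (transfer, rule ext)
    fix a :: "'b list \<Rightarrow> 'a" and w
    have "(\<Sum>(p, q)\<in>splits w. (if p = [] then 1 else 0) * a q)
        = (\<Sum>(p, q)\<in>{([] :: 'b list, w)}. (if p = [] then 1 else 0) * a q)"
      by (rule sum.mono_neutral_right) (simp, auto simp: splits_def split: if_splits)
    then show "(\<Sum>(p, q)\<in>splits w. (if p = [] then 1 else 0) * a q) = a w" by simp
  qed
  show "a * 1 = a"
  proof (transfer, rule ext)
    fix a :: "'b list \<Rightarrow> 'a" and w
    have "(\<Sum>(p, q)\<in>splits w. a p * (if q = [] then 1 else 0))
        = (\<Sum>(p, q)\<in>{(w, [] :: 'b list)}. a p * (if q = [] then 1 else 0))"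
      by (rule sum.mono_neutral_right) (simp, auto simp: splits_def split: if_splits)
    then show "(\<Sum>(p, q)\<in>splits w. a p * (if q = [] then 1 else 0)) = a w" by simp
  qed
  show "(a + b) * c = a * c + b * c"
    by transfer (auto simp: fun_eq_iff sum.distrib [symmetric] algebra_simps intro!: sum.cong)
  show "a * (b + c) = a * b + a * c"
    by transfer (auto simp: fun_eq_iff sum.distrib [symmetric] algebra_simps intro!: sum.cong)
  show "(0 :: ('a, 'b) nc_fps) \<noteq> 1"
    by transfer (auto simp: fun_eq_iff intro!: exI [of _ "[]"])
qed (transfer; auto simp: algebra_simps)+

end

text \<open>\<open>nc_map\<close> acts coefficientwise.\<close>

lift_definition nc_map :: "('a \<Rightarrow> 'b) \<Rightarrow> ('a, 'n) nc_fps \<Rightarrow> ('b, 'n) nc_fps"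
  is "\<lambda>\<phi> f w. \<phi> (f w)" .

definition nc_scale :: "'a \<Rightarrow> ('a, 'n) nc_fps \<Rightarrow> ('a :: ring_1, 'n) nc_fps" where
  "nc_scale c = nc_map ((*) c)"

lift_definition nc_var :: "'n \<Rightarrow> ('a :: ring_1, 'n) nc_fps"
  is "\<lambda>i w. if w = [i] then 1 else 0" .

definition nc_vars :: "('a :: ring_1, 'n :: finite) nc_fps ^ 'n" where
  "nc_vars = (\<chi> i. nc_var i)"

text \<open>The order is \<open>\<infinity>\<close> exactly for the zero series (vector).\<close>

definition nc_order :: "('a :: ring_1, 'n) nc_fps \<Rightarrow> enat" where
  "nc_order f = (INF w\<in>{w. nc_nth f w \<noteq> 0}. enat (length w))"

definition nc_vorder :: "('a :: ring_1, 'n :: finite) nc_fps ^ 'n \<Rightarrow> enat" where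
  "nc_vorder U = (INF i. nc_order (U $ i))"

section \<open>Substitution and inverse maps\<close>

text \<open>
  \<open>nc_subst u F\<close> is \<open>u(F)\<close>, the image of \<open>u = \<Sum>\<^sub>v u\<^sub>v z\<^sub>v\<close> under the continuous algebra endomorphism
  \<open>z\<^sub>i \<mapsto> F\<^sub>i\<close>. It is meaningful only if \<open>F\<close> has order at least \<open>1\<close>: then the product of the
  \<open>F\<^sub>i\<close> along a word \<open>v\<close> has order at least \<open>length v\<close>, so only the words \<open>v\<close> with
  \<open>length v \<le> length w\<close> contribute to the coefficient of \<open>w\<close>.
\<close>

lift_definition nc_subst ::
  "('a :: comm_ring_1, 'n :: finite) nc_fps \<Rightarrow> ('a, 'n) nc_fps ^ 'n \<Rightarrow> ('a, 'n) nc_fps"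
  is "\<lambda>u F w. \<Sum>v | length v \<le> length w. u v * nc_nth (prod_list (map (($) F) v)) w" .

definition nc_vsubst ::
  "('a :: comm_ring_1, 'n :: finite) nc_fps ^ 'n \<Rightarrow> ('a, 'n) nc_fps ^ 'n \<Rightarrow> ('a, 'n) nc_fps ^ 'n"
  where "nc_vsubst U F = (\<chi> i. nc_subst (U $ i) F)"

text \<open>
  The condition \<open>nc_vorder G \<ge> 1\<close> is needed for the substitution of \<open>G\<close> to make sense. The
  inverse map exists uniquely for \<open>F = z - H\<close> with \<open>o(H) \<ge> 2\<close>; see \<open>nc_inverse_map_ex1\<close>.
\<close>

definition nc_inverse_map ::
  "('a :: comm_ring_1, 'n :: finite) nc_fps ^ 'n \<Rightarrow> ('a, 'n) nc_fps ^ 'n" where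
  "nc_inverse_map F =
     (THE G. nc_vorder G \<ge> 1 \<and> nc_vsubst F G = nc_vars \<and> nc_vsubst G F = nc_vars)"

section \<open>Derivations\<close>

definition nc_derivation ::
  "(('a :: comm_ring_1, 'n) nc_fps \<Rightarrow> ('a, 'n) nc_fps) \<Rightarrow> bool" where
  "nc_derivation D \<longleftrightarrow>
     (\<forall>f g. D (f + g) = D f + D g) \<and>
     (\<forall>c f. D (nc_scale c f) = nc_scale c (D f)) \<and>
     (\<forall>f g. D (f * g) = D f * g + f * D g)"

text \<open>The derivation \<open>[u \<partial>/\<partial>z]\<close>; it exists uniquely by \<open>nc_vector_field_ex1\<close>.\<close>

definition nc_vector_field ::
  "('a :: comm_ring_1, 'n :: finite) nc_fps ^ 'n \<Rightarrow> ('a, 'n) nc_fps \<Rightarrow> ('a, 'n) nc_fps" where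
  "nc_vector_field u = (THE D. nc_derivation D \<and> (\<forall>i. D (nc_var i) = u $ i))"

section \<open>Series over \<open>k[[t]]\<close>\<close>

definition nc_dt :: "('a :: comm_ring_1 fps, 'n) nc_fps \<Rightarrow> ('a fps, 'n) nc_fps" where
  "nc_dt = nc_map fps_deriv"

definition nc_vdt ::
  "('a :: comm_ring_1 fps, 'n :: finite) nc_fps ^ 'n \<Rightarrow> ('a fps, 'n) nc_fps ^ 'n" where
  "nc_vdt U = (\<chi> i. nc_dt (U $ i))"

text \<open>The inclusion of the series over \<open>k\<close> into those over \<open>k[[t]]\<close>.\<close>

definition nc_embed :: "('a :: comm_ring_1, 'n) nc_fps \<Rightarrow> ('a fps, 'n) nc_fps" where
  "nc_embed = nc_map fps_const"

section \<open>Well-definedness of the definite descriptions\<close>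

subsection \<open>Coefficients\<close>

lemma nc_nth_simps [simp]:
  "nc_nth 0 w = 0"
  "nc_nth 1 w = (if w = [] then 1 else 0)"
  "nc_nth (f + g) w = nc_nth f w + nc_nth g w"
  "nc_nth (f - g) w = nc_nth f w - nc_nth g w"
  "nc_nth (- f) w = - nc_nth f w"
  "nc_nth (nc_scale c f) w = c * nc_nth f w"
  "nc_nth (nc_var i) w = (if w = [i] then 1 else 0)"
  unfolding nc_scale_def by (transfer; simp)+

lemma nc_nth_times: "nc_nth (f * g) w = (\<Sum>(p, q)\<in>splits w. nc_nth f p * nc_nth g q)"
  by transfer simp

lemma nc_nth_times_Nil [simp]: "nc_nth (f * g) [] = nc_nth f [] * nc_nth g []"
  by (simp add: nc_nth_times)

lemma nc_nth_sum [simp]: "nc_nth (sum f A) w = (\<Sum>x\<in>A. nc_nth (f x) w)"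
  by (induction A rule: infinite_finite_induct) auto

lift_definition nc_shift :: "'n \<Rightarrow> ('a, 'n) nc_fps \<Rightarrow> ('a, 'n) nc_fps" is "\<lambda>i f w. f (i # w)" .

lemma nc_nth_shift [simp]: "nc_nth (nc_shift i f) w = nc_nth f (i # w)"
  by transfer simp

lemma nc_nth_times_Cons:
  "nc_nth (f * g) (x # w) = nc_nth f [] * nc_nth g (x # w) + nc_nth (nc_shift x f * g) w"
proof -
  have "inj_on (apfst ((#) x)) (splits w)"
    by (auto simp: inj_on_def)
  then show ?thesis
    by (simp add: nc_nth_times splits_Cons case_prod_unfold)
       (subst sum.insert; auto simp: sum.reindex case_prod_unfold o_def)
qed

lemma nc_shift_times: "nc_shift i (f * g) = nc_scale (nc_nth f []) (nc_shift i g) + nc_shift i f * g"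
  by (rule nc_fps_eqI) (simp add: nc_nth_times_Cons)

lemma nc_shift_var: "nc_shift i (nc_var j) = (if i = j then 1 else 0)"
  by (rule nc_fps_eqI) auto

lemma nc_scale_mult_left: "nc_scale c f * g = nc_scale c (f * g)"
  by (rule nc_fps_eqI) (simp add: nc_nth_times sum_distrib_left case_prod_unfold mult.assoc)

lemma nc_scale_mult_right: "f * nc_scale c g = nc_scale c (f * g)"
  for c :: "'a :: comm_ring_1"
  by (rule nc_fps_eqI)
     (simp add: nc_nth_times sum_distrib_left case_prod_unfold mult.left_commute)

lemma nc_var_times_Nil: "nc_nth (nc_var i * f) [] = 0"
  by simp

lemma nc_var_times_Cons: "nc_nth (nc_var i * f) (x # w) = (if i = x then nc_nth f w else 0)"
  by (simp add: nc_nth_times_Cons nc_shift_var)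

lemma nc_decompose:
  fixes f :: "('a :: ring_1, 'n :: finite) nc_fps"
  shows "f = nc_scale (nc_nth f []) 1 + (\<Sum>i\<in>UNIV. nc_var i * nc_shift i f)"
proof (rule nc_fps_eqI)
  fix w
  show "nc_nth f w = nc_nth (nc_scale (nc_nth f []) 1 + (\<Sum>i\<in>UNIV. nc_var i * nc_shift i f)) w"
    by (cases w) (simp_all add: nc_var_times_Cons del: nc_nth_shift, simp)
qed

lemma additive_sum:
  fixes D :: "'x :: ab_group_add \<Rightarrow> 'y :: ab_group_add"
  assumes "\<And>f g. D (f + g) = D f + D g"
  shows "D (sum f A) = (\<Sum>x\<in>A. D (f x))"
proof -
  have "D 0 = 0" using assms [of 0 0] by simp
  then show ?thesis by (induction A rule: infinite_finite_induct) (auto simp: assms)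
qed

subsection \<open>The derivation \<open>[u \<partial>/\<partial>z]\<close>\<close>

lemma nc_derivation_one:
  fixes D :: "('a :: comm_ring_1, 'n) nc_fps \<Rightarrow> ('a, 'n) nc_fps"
  assumes "nc_derivation D" shows "D 1 = 0"
  using assms unfolding nc_derivation_def by (metis add_cancel_right_right mult_1 mult_1_right)

lemma nc_derivation_unique:
  fixes D E :: "('a :: comm_ring_1, 'n :: finite) nc_fps \<Rightarrow> ('a, 'n) nc_fps"
  assumes D: "nc_derivation D" and E: "nc_derivation E"
    and eq: "\<And>i. D (nc_var i) = E (nc_var i)"
  shows "D = E"
proof -
  have step: "D f = (\<Sum>i\<in>UNIV. D (nc_var i) * nc_shift i f + nc_var i * D (nc_shift i f))"
    if D: "nc_derivation D" for D :: "('a, 'n) nc_fps \<Rightarrow> ('a, 'n) nc_fps" and f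
  proof -
    have add: "\<And>f g. D (f + g) = D f + D g" using D by (simp add: nc_derivation_def)
    have "D f = D (nc_scale (nc_nth f []) 1 + (\<Sum>i\<in>UNIV. nc_var i * nc_shift i f))"
      using nc_decompose [of f] by simp
    also have "\<dots> = nc_scale (nc_nth f []) (D 1) + (\<Sum>i\<in>UNIV. D (nc_var i * nc_shift i f))"
      using D by (simp add: add additive_sum [of D, OF add] nc_derivation_def)
    also have "nc_scale (nc_nth f []) (D 1) = 0"
      by (rule nc_fps_eqI) (simp add: nc_derivation_one [OF D])
    finally show ?thesis using D by (simp add: nc_derivation_def)
  qed
  have "nc_nth (D f) w = nc_nth (E f) w" for f w
  proof (induction w arbitrary: f)
    case Nil
    show ?case by (subst step [OF D], subst step [OF E]) (simp add: eq)
  next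
    case (Cons x w)
    show ?case
      by (subst step [OF D], subst step [OF E]) (auto simp: eq nc_var_times_Cons Cons.IH intro!: sum.cong)
  qed
  then show ?thesis by (intro ext nc_fps_eqI) 
qed

definition splits3 :: "'n list \<Rightarrow> ('n list \<times> 'n list \<times> 'n list) set" where
  "splits3 w = {(p, r, q). p @ r @ q = w}"

lemma finite_splits3 [simp]: "finite (splits3 w)"
proof -
  have "splits3 w = (\<lambda>((p, x), (r, q)). (p, r, q)) ` Sigma (splits w) (\<lambda>(p, x). splits x)"
    by (force simp: splits3_def splits_def image_iff)
  moreover have "finite (Sigma (splits w) (\<lambda>(p, x). splits x))"
    by (rule finite_SigmaI) auto
  ultimately show ?thesis by simp
qed

lift_definition nc_field ::
  "('a :: comm_ring_1, 'n :: finite) nc_fps ^ 'n \<Rightarrow> ('a, 'n) nc_fps \<Rightarrow> ('a, 'n) nc_fps"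
  is "\<lambda>u f w. \<Sum>i\<in>UNIV. \<Sum>(p, r, q)\<in>splits3 w. f (p @ i # q) * nc_nth (u $ i) r" .

lemma nc_nth_field:
  "nc_nth (nc_field u f) w =
     (\<Sum>i\<in>UNIV. \<Sum>(p, r, q)\<in>splits3 w. nc_nth f (p @ i # q) * nc_nth (u $ i) r)"
  by transfer simp

lemma splits_middle:
  "splits (p @ i # q) = (\<lambda>(a, b). (a, b @ i # q)) ` splits p \<union> (\<lambda>(a, b). (p @ i # a, b)) ` splits q"
  by (fastforce simp: splits_def append_eq_append_conv2 Cons_eq_append_conv append_eq_Cons_conv image_iff)

lemma sum_splits_middle:
  fixes F :: "'n list \<times> 'n list \<Rightarrow> 'a :: comm_monoid_add"
  shows "sum F (splits (p @ i # q)) =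
    (\<Sum>(a, b)\<in>splits p. F (a, b @ i # q)) + (\<Sum>(a, b)\<in>splits q. F (p @ i # a, b))"
proof -
  have "sum F (splits (p @ i # q)) = sum F ((\<lambda>(a, b). (a, b @ i # q)) ` splits p)
      + sum F ((\<lambda>(a, b). (p @ i # a, b)) ` splits q)"
    unfolding splits_middle by (rule sum.union_disjoint) (simp_all, auto simp: splits_def)
  also have "sum F ((\<lambda>(a, b). (a, b @ i # q)) ` splits p) = (\<Sum>(a, b)\<in>splits p. F (a, b @ i # q))"
    by (subst sum.reindex) (auto simp: inj_on_def intro!: sum.cong)
  also have "sum F ((\<lambda>(a, b). (p @ i # a, b)) ` splits q) = (\<Sum>(a, b)\<in>splits q. F (p @ i # a, b))"
    by (subst sum.reindex) (auto simp: inj_on_def intro!: sum.cong)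
  finally show ?thesis .
qed

lemma nc_field_times: "nc_field u (f * g) = nc_field u f * g + f * nc_field u g"
proof (rule nc_fps_eqI)
  fix w :: "'b list"
  let ?f = "nc_nth f" and ?g = "nc_nth g" and ?u = "\<lambda>i. nc_nth (u $ i)"
  have 1: "(\<Sum>(p, r, q)\<in>splits3 w. (\<Sum>(a, b)\<in>splits p. ?f a * ?g (b @ i # q)) * ?u i r)
      = (\<Sum>(c, d)\<in>splits w. \<Sum>(p, r, q)\<in>splits3 d. ?f c * (?g (p @ i # q) * ?u i r))" for i
  proof -
    have "(\<Sum>(p, r, q)\<in>splits3 w. (\<Sum>(a, b)\<in>splits p. ?f a * ?g (b @ i # q)) * ?u i r)
       = (\<Sum>((p, r, q), (a, b))\<in>Sigma (splits3 w) (\<lambda>(p, r, q). splits p). ?f a * (?g (b @ i # q) * ?u i r))"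
      by (simp add: sum.Sigma sum_distrib_right case_prod_unfold mult.assoc)
    also have "\<dots> = (\<Sum>((c, d), (p, r, q))\<in>Sigma (splits w) (\<lambda>(c, d). splits3 d). ?f c * (?g (p @ i # q) * ?u i r))"
      by (rule sum.reindex_bij_witness
            [where i = "\<lambda>((c, d), (p, r, q)). ((c @ p, r, q), (c, p))"
               and j = "\<lambda>((p, r, q), (a, b)). ((a, b @ r @ q), (b, r, q))"])
         (auto simp: splits_def splits3_def)
    also have "\<dots> = (\<Sum>(c, d)\<in>splits w. \<Sum>(p, r, q)\<in>splits3 d. ?f c * (?g (p @ i # q) * ?u i r))"
      by (simp add: sum.Sigma case_prod_unfold)
    finally show ?thesis .
  qed
  have 2: "(\<Sum>(p, r, q)\<in>splits3 w. (\<Sum>(a, b)\<in>splits q. ?f (p @ i # a) * ?g b) * ?u i r)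
      = (\<Sum>(c, d)\<in>splits w. \<Sum>(p, r, q)\<in>splits3 c. ?f (p @ i # q) * ?u i r * ?g d)" for i
  proof -
    have "(\<Sum>(p, r, q)\<in>splits3 w. (\<Sum>(a, b)\<in>splits q. ?f (p @ i # a) * ?g b) * ?u i r)
       = (\<Sum>((p, r, q), (a, b))\<in>Sigma (splits3 w) (\<lambda>(p, r, q). splits q). ?f (p @ i # a) * ?u i r * ?g b)"
      by (simp add: sum.Sigma sum_distrib_right case_prod_unfold)
         (simp add: ac_simps)
    also have "\<dots> = (\<Sum>((c, d), (p, r, q))\<in>Sigma (splits w) (\<lambda>(c, d). splits3 c). ?f (p @ i # q) * ?u i r * ?g d)"
      by (rule sum.reindex_bij_witness
            [where i = "\<lambda>((c, d), (p, r, q)). ((p, r, q @ d), (q, d))"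
               and j = "\<lambda>((p, r, q), (a, b)). ((p @ r @ a, b), (p, r, a))"])
         (auto simp: splits_def splits3_def)
    also have "\<dots> = (\<Sum>(c, d)\<in>splits w. \<Sum>(p, r, q)\<in>splits3 c. ?f (p @ i # q) * ?u i r * ?g d)"
      by (simp add: sum.Sigma case_prod_unfold)
    finally show ?thesis .
  qed
  have "nc_nth (nc_field u (f * g)) w
      = (\<Sum>i\<in>UNIV. \<Sum>(c, d)\<in>splits w. \<Sum>(p, r, q)\<in>splits3 d. ?f c * (?g (p @ i # q) * ?u i r))
      + (\<Sum>i\<in>UNIV. \<Sum>(c, d)\<in>splits w. \<Sum>(p, r, q)\<in>splits3 c. ?f (p @ i # q) * ?u i r * ?g d)"
    unfolding 1 [symmetric] 2 [symmetric]
    by (simp add: nc_nth_field nc_nth_times sum_splits_middle sum.distrib case_prod_unfold distrib_right)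
  also have "(\<Sum>i\<in>UNIV. \<Sum>(c, d)\<in>splits w. \<Sum>(p, r, q)\<in>splits3 d. ?f c * (?g (p @ i # q) * ?u i r))
      = nc_nth (f * nc_field u g) w"
    by (simp add: nc_nth_field nc_nth_times case_prod_unfold sum_distrib_left)
       (subst sum.swap, rule refl)
  also have "(\<Sum>i\<in>UNIV. \<Sum>(c, d)\<in>splits w. \<Sum>(p, r, q)\<in>splits3 c. ?f (p @ i # q) * ?u i r * ?g d)
      = nc_nth (nc_field u f * g) w"
    by (simp add: nc_nth_field nc_nth_times case_prod_unfold sum_distrib_right)
       (subst sum.swap, rule refl)
  finally show "nc_nth (nc_field u (f * g)) w = nc_nth (nc_field u f * g + f * nc_field u g) w"
    by simp
qed

lemma nc_derivation_field: "nc_derivation (nc_field u)"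
  unfolding nc_derivation_def
proof (intro conjI allI)
  show "nc_field u (f + g) = nc_field u f + nc_field u g" for f g
    by (rule nc_fps_eqI) (simp add: nc_nth_field distrib_right sum.distrib case_prod_unfold)
  show "nc_field u (nc_scale c f) = nc_scale c (nc_field u f)" for c f
    by (rule nc_fps_eqI) (simp add: nc_nth_field sum_distrib_left case_prod_unfold mult.assoc)
qed (rule nc_field_times)

lemma nc_field_var: "nc_field u (nc_var i) = u $ i"
proof (rule nc_fps_eqI)
  fix w
  have "(\<Sum>(p, r, q)\<in>splits3 w. nc_nth (nc_var i) (p @ j # q) * nc_nth (u $ j) r)
      = (\<Sum>(p, r, q)\<in>{([], w, [])}. nc_nth (nc_var i) (p @ j # q) * nc_nth (u $ j) r)" for j
    by (rule sum.mono_neutral_right) (simp, auto simp: splits3_def append_eq_Cons_conv split: if_splits)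
  then show "nc_nth (nc_field u (nc_var i)) w = nc_nth (u $ i) w"
    by (simp add: nc_nth_field if_distrib [of "\<lambda>x. x * _"] cong: if_cong)
qed

lemma nc_vector_field_ex1: "\<exists>!D. nc_derivation D \<and> (\<forall>i. D (nc_var i) = u $ i)"
proof (rule ex1I [of _ "nc_field u"])
  show "nc_derivation (nc_field u) \<and> (\<forall>i. nc_field u (nc_var i) = u $ i)"
    by (simp add: nc_derivation_field nc_field_var)
next
  fix D assume "nc_derivation D \<and> (\<forall>i. D (nc_var i) = u $ i)"
  then show "D = nc_field u"
    by (intro nc_derivation_unique) (simp_all add: nc_derivation_field nc_field_var)
qed

lemma nc_vector_field:
  "nc_derivation (nc_vector_field u)" "nc_vector_field u (nc_var i) = u $ i"
  using theI' [OF nc_vector_field_ex1 [of u]] by (simp_all add: nc_vector_field_def)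

subsection \<open>Composition and inverse maps\<close>

lemma nc_order_ge: "enat n \<le> nc_order f \<longleftrightarrow> (\<forall>w. length w < n \<longrightarrow> nc_nth f w = 0)"
  unfolding nc_order_def le_INF_iff by (auto, meson not_less)

lemma nc_vorder_ge:
  "enat n \<le> nc_vorder U \<longleftrightarrow> (\<forall>i w. length w < n \<longrightarrow> nc_nth (U $ i) w = 0)"
  by (auto simp: nc_vorder_def le_INF_iff nc_order_ge)

lemma nc_vorder_ge_1: "1 \<le> nc_vorder U \<longleftrightarrow> (\<forall>i. nc_nth (U $ i) [] = 0)"
  using nc_vorder_ge [of 1 U] by (simp add: one_enat_def)

lemma nc_vorder_ge_2:
  "2 \<le> nc_vorder U \<longleftrightarrow> (\<forall>i w. length w < 2 \<longrightarrow> nc_nth (U $ i) w = 0)"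
  using nc_vorder_ge [of 2 U] by (simp add: numeral_eq_enat)

lemma nc_nth_times_cong:
  assumes "nc_nth g [] = 0" and "\<And>q. length q < length w \<Longrightarrow> nc_nth x q = nc_nth y q"
  shows "nc_nth (g * x) w = nc_nth (g * y) w"
  unfolding nc_nth_times
proof (rule sum.cong [OF refl], clarify)
  fix p q assume "(p, q) \<in> splits w"
  then have "p = [] \<or> length q < length w" by (auto simp: splits_def)
  then show "nc_nth g p * nc_nth x q = nc_nth g p * nc_nth y q"
    using assms by auto
qed

lemma nc_nth_prod_list:
  fixes G :: "('a :: comm_ring_1, 'n :: finite) nc_fps ^ 'n"
  assumes G: "1 \<le> nc_vorder G" and "length w < length v"
  shows "nc_nth (prod_list (map (($) G) v)) w = 0"
  using assms(2)
proof (induction v arbitrary: w)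
  case (Cons i v)
  have "nc_nth (G $ i * prod_list (map (($) G) v)) w = nc_nth (G $ i * 0) w"
    using G Cons by (intro nc_nth_times_cong) (auto simp: nc_vorder_ge_1)
  then show ?case by simp
qed simp

lemma finite_words [simp]: "finite {v :: 'n :: finite list. length v \<le> n}"
  using finite_lists_length_le [of "UNIV :: 'n set" n] by simp

lemma nc_nth_subst:
  fixes G :: "('a :: comm_ring_1, 'n :: finite) nc_fps ^ 'n"
  assumes G: "1 \<le> nc_vorder G" and "length w \<le> n"
  shows "nc_nth (nc_subst f G) w =
    (\<Sum>v | length v \<le> n. nc_nth f v * nc_nth (prod_list (map (($) G) v)) w)"
proof -
  have "(\<Sum>v | length v \<le> n. nc_nth f v * nc_nth (prod_list (map (($) G) v)) w)
      = (\<Sum>v | length v \<le> length w. nc_nth f v * nc_nth (prod_list (map (($) G) v)) w)"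
    using assms by (intro sum.mono_neutral_right) (auto simp: nc_nth_prod_list)
  then show ?thesis by (simp add: nc_subst.rep_eq)
qed

lemma words_Suc:
  "{v :: 'n list. length v \<le> Suc n} = insert [] (\<Union>i. (#) i ` {v. length v \<le> n})"
  (is "?A = ?B")
proof (rule set_eqI)
  fix v :: "'n list"
  show "v \<in> ?A \<longleftrightarrow> v \<in> ?B" by (cases v) auto
qed

lemma nc_subst_step:
  fixes G :: "('a :: comm_ring_1, 'n :: finite) nc_fps ^ 'n"
  assumes G: "1 \<le> nc_vorder G"
  shows "nc_subst f G =
    nc_scale (nc_nth f []) 1 + (\<Sum>i\<in>UNIV. G $ i * nc_subst (nc_shift i f) G)"
proof (rule nc_fps_eqI)
  fix w :: "'n list"
  let ?P = "\<lambda>v. prod_list (map (($) G) v)" and ?n = "length w"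
  have "nc_nth (G $ i * nc_subst (nc_shift i f) G) w
      = (\<Sum>v | length v \<le> ?n. nc_nth f (i # v) * nc_nth (?P (i # v)) w)" for i
  proof -
    have "nc_nth (G $ i * nc_subst (nc_shift i f) G) w
        = (\<Sum>(p, q)\<in>splits w. \<Sum>v | length v \<le> ?n. nc_nth (G $ i) p * (nc_nth f (i # v) * nc_nth (?P v) q))"
      unfolding nc_nth_times
    proof (rule sum.cong [OF refl], clarify)
      fix p q assume "(p, q) \<in> splits w"
      then have "length q \<le> ?n" by (auto simp: splits_def)
      then show "nc_nth (G $ i) p * nc_nth (nc_subst (nc_shift i f) G) q
          = (\<Sum>v | length v \<le> ?n. nc_nth (G $ i) p * (nc_nth f (i # v) * nc_nth (?P v) q))"
        by (simp add: nc_nth_subst [OF G] sum_distrib_left)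
    qed
    also have "\<dots> = (\<Sum>v | length v \<le> ?n. \<Sum>(p, q)\<in>splits w. nc_nth (G $ i) p * (nc_nth f (i # v) * nc_nth (?P v) q))"
      unfolding case_prod_unfold by (rule sum.swap)
    also have "\<dots> = (\<Sum>v | length v \<le> ?n. nc_nth f (i # v) * nc_nth (?P (i # v)) w)"
      by (simp add: nc_nth_times sum_distrib_left case_prod_unfold mult.left_commute)
    finally show ?thesis .
  qed
  note 1 = this
  have "nc_nth (nc_subst f G) w = (\<Sum>v | length v \<le> Suc ?n. nc_nth f v * nc_nth (?P v) w)"
    by (rule nc_nth_subst [OF G]) simp
  also have "\<dots> = nc_nth f [] * nc_nth (?P []) w
      + (\<Sum>v\<in>(\<Union>i. (#) i ` {v. length v \<le> ?n}). nc_nth f v * nc_nth (?P v) w)"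
    unfolding words_Suc by (subst sum.insert) auto
  also have "(\<Sum>v\<in>(\<Union>i. (#) i ` {v. length v \<le> ?n}). nc_nth f v * nc_nth (?P v) w)
      = (\<Sum>i\<in>UNIV. \<Sum>v\<in>(#) i ` {v. length v \<le> ?n}. nc_nth f v * nc_nth (?P v) w)"
    by (rule sum.UNION_disjoint) auto
  also have "\<dots> = (\<Sum>i\<in>UNIV. \<Sum>v | length v \<le> ?n. nc_nth f (i # v) * nc_nth (?P (i # v)) w)"
    by (simp add: sum.reindex o_def)
  finally show "nc_nth (nc_subst f G) w = nc_nth (nc_scale (nc_nth f []) 1
      + (\<Sum>i\<in>UNIV. G $ i * nc_subst (nc_shift i f) G)) w"
    by (simp add: 1)
qed

lemma nc_subst_add: "nc_subst (f + g) G = nc_subst f G + nc_subst g G"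
  by (rule nc_fps_eqI) (simp add: nc_subst.rep_eq distrib_right sum.distrib)

lemma nc_subst_diff: "nc_subst (f - g) G = nc_subst f G - nc_subst g G"
  by (rule nc_fps_eqI) (simp add: nc_subst.rep_eq left_diff_distrib sum_subtractf)

lemma nc_subst_scale: "nc_subst (nc_scale c f) G = nc_scale c (nc_subst f G)"
  by (rule nc_fps_eqI) (simp add: nc_subst.rep_eq sum_distrib_left mult.assoc)

lemma nc_subst_0 [simp]: "nc_subst 0 G = 0"
  by (rule nc_fps_eqI) (simp add: nc_subst.rep_eq)

lemma nc_shift_1 [simp]: "nc_shift i 1 = 0"
  by (rule nc_fps_eqI) simp

lemma nc_scale_0_1 [simp]: "nc_scale 0 f = 0" "nc_scale 1 f = f"
  by (rule nc_fps_eqI, simp)+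

lemma nc_subst_1: "1 \<le> nc_vorder G \<Longrightarrow> nc_subst 1 G = 1"
  by (subst nc_subst_step) auto

lemma nc_subst_var: "1 \<le> nc_vorder G \<Longrightarrow> nc_subst (nc_var i) G = G $ i"
  by (subst nc_subst_step)
     (auto simp: nc_shift_var nc_subst_1 if_distrib [of "\<lambda>f. nc_subst f G"]
        if_distrib [of "\<lambda>f. _ * f"] cong: if_cong)

lemma nc_subst_mult:
  fixes G :: "('a :: comm_ring_1, 'n :: finite) nc_fps ^ 'n"
  assumes G: "1 \<le> nc_vorder G"
  shows "nc_subst (f * g) G = nc_subst f G * nc_subst g G"
proof (rule nc_fps_eqI)
  fix w
  show "nc_nth (nc_subst (f * g) G) w = nc_nth (nc_subst f G * nc_subst g G) w"
  proof (induction w arbitrary: f rule: length_induct)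
    case (1 w)
    have "nc_subst (f * g) G = nc_scale (nc_nth f []) (nc_scale (nc_nth g []) 1)
        + (\<Sum>i\<in>UNIV. G $ i * (nc_scale (nc_nth f []) (nc_subst (nc_shift i g) G)
              + nc_subst (nc_shift i f * g) G))"
      by (subst nc_subst_step [OF G])
         (simp add: nc_shift_times nc_subst_add nc_subst_scale, rule nc_fps_eqI, simp)
    also have "nc_nth \<dots> w = nc_nth (nc_scale (nc_nth f []) (nc_scale (nc_nth g []) 1)
        + (\<Sum>i\<in>UNIV. G $ i * (nc_scale (nc_nth f []) (nc_subst (nc_shift i g) G)
              + nc_subst (nc_shift i f) G * nc_subst g G))) w"
      using G 1 by (auto simp: nc_vorder_ge_1 intro!: sum.cong nc_nth_times_cong)
    also have "nc_scale (nc_nth f []) (nc_scale (nc_nth g []) 1)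
        + (\<Sum>i\<in>UNIV. G $ i * (nc_scale (nc_nth f []) (nc_subst (nc_shift i g) G)
              + nc_subst (nc_shift i f) G * nc_subst g G))
      = nc_scale (nc_nth f []) (nc_scale (nc_nth g []) 1 + (\<Sum>i\<in>UNIV. G $ i * nc_subst (nc_shift i g) G))
        + (\<Sum>i\<in>UNIV. G $ i * nc_subst (nc_shift i f) G) * nc_subst g G"
      by (rule nc_fps_eqI)
         (simp add: distrib_left nc_scale_mult_right sum.distrib sum_distrib_left sum_distrib_right
            mult.assoc)
    also have "\<dots> = nc_scale (nc_nth f []) (nc_subst g G)
        + (\<Sum>i\<in>UNIV. G $ i * nc_subst (nc_shift i f) G) * nc_subst g G"
      using nc_subst_step [OF G, of g] by simp
    also have "\<dots> = nc_subst f G * nc_subst g G"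
      using nc_subst_step [OF G, of f] by (simp add: distrib_right nc_scale_mult_left)
    finally show ?case .
  qed
qed

lemma nc_hom_unique:
  fixes \<phi> :: "('a :: comm_ring_1, 'n :: finite) nc_fps \<Rightarrow> ('a, 'n) nc_fps"
  assumes add: "\<And>f g. \<phi> (f + g) = \<phi> f + \<phi> g" and scale: "\<And>c f. \<phi> (nc_scale c f) = nc_scale c (\<phi> f)"
    and mult: "\<And>f g. \<phi> (f * g) = \<phi> f * \<phi> g" and one: "\<phi> 1 = 1"
    and G: "\<And>i. \<phi> (nc_var i) = G $ i" "1 \<le> nc_vorder G"
  shows "\<phi> f = nc_subst f G"
proof (rule nc_fps_eqI)
  fix w
  show "nc_nth (\<phi> f) w = nc_nth (nc_subst f G) w"
  proof (induction w arbitrary: f rule: length_induct)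
    case (1 w)
    have "\<phi> f = \<phi> (nc_scale (nc_nth f []) 1 + (\<Sum>i\<in>UNIV. nc_var i * nc_shift i f))"
      using nc_decompose [of f] by simp
    also have "\<dots> = nc_scale (nc_nth f []) 1 + (\<Sum>i\<in>UNIV. G $ i * \<phi> (nc_shift i f))"
      by (simp add: add scale mult one G(1) additive_sum [of \<phi>, OF add])
    also have "nc_nth \<dots> w = nc_nth (nc_scale (nc_nth f []) 1
        + (\<Sum>i\<in>UNIV. G $ i * nc_subst (nc_shift i f) G)) w"
      using G(2) 1 by (auto simp: nc_vorder_ge_1 intro!: sum.cong nc_nth_times_cong)
    finally show ?case using nc_subst_step [OF G(2), of f] by simp
  qed
qed

lemma nc_nth_subst_Nil: "nc_nth (nc_subst f G) [] = nc_nth f []"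
  by (simp add: nc_subst.rep_eq)

lemma nc_vorder_vsubst: "1 \<le> nc_vorder F \<Longrightarrow> 1 \<le> nc_vorder (nc_vsubst F G)"
  by (simp add: nc_vorder_ge_1 nc_vsubst_def nc_nth_subst_Nil)

lemma nc_subst_assoc:
  assumes "1 \<le> nc_vorder F" "1 \<le> nc_vorder G"
  shows "nc_subst (nc_subst f F) G = nc_subst f (nc_vsubst F G)"
  by (rule nc_hom_unique [where \<phi> = "\<lambda>f. nc_subst (nc_subst f F) G"])
     (simp_all add: assms nc_subst_add nc_subst_scale nc_subst_mult nc_subst_1 nc_subst_var
       nc_vorder_vsubst, simp add: nc_vsubst_def)

lemma nc_vsubst_assoc:
  assumes "1 \<le> nc_vorder F" "1 \<le> nc_vorder G"
  shows "nc_vsubst (nc_vsubst U F) G = nc_vsubst U (nc_vsubst F G)"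
  by (simp add: nc_vsubst_def [of _ G] nc_vsubst_def [of _ F] nc_vsubst_def [of U]
      nc_subst_assoc [OF assms] vec_eq_iff)

lemma nc_vorder_vars: "1 \<le> nc_vorder nc_vars"
  by (simp add: nc_vorder_ge_1 nc_vars_def)

lemma nc_subst_vars [simp]: "nc_subst f nc_vars = f"
  by (rule nc_hom_unique [symmetric, where \<phi> = "\<lambda>f. f"]) (simp_all add: nc_vorder_vars, simp add: nc_vars_def)

lemma nc_vsubst_vars [simp]: "nc_vsubst U nc_vars = U"
  by (simp add: nc_vsubst_def vec_eq_iff)

lemma nc_vars_vsubst: "1 \<le> nc_vorder G \<Longrightarrow> nc_vsubst nc_vars G = G"
  by (simp add: nc_vsubst_def vec_eq_iff nc_vars_def nc_subst_var)

lemma nc_vsubst_diff: "nc_vsubst (U - V) G = nc_vsubst U G - nc_vsubst V G"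
  by (simp add: nc_vsubst_def vec_eq_iff nc_subst_diff)

lemma nc_nth_prod_list_cong:
  fixes A B :: "('a :: comm_ring_1, 'n :: finite) nc_fps ^ 'n"
  assumes A: "1 \<le> nc_vorder A" and B: "1 \<le> nc_vorder B"
    and eq: "\<And>i w. length w \<le> n \<Longrightarrow> nc_nth (A $ i) w = nc_nth (B $ i) w"
    and "Suc (length w) \<le> n + length v"
  shows "nc_nth (prod_list (map (($) A) v)) w = nc_nth (prod_list (map (($) B) v)) w"
  using assms(4)
proof (induction v arbitrary: w)
  case (Cons i v)
  have "nc_nth (A $ i) p * nc_nth (prod_list (map (($) A) v)) q
      = nc_nth (B $ i) p * nc_nth (prod_list (map (($) B) v)) q" if "p @ q = w" for p q
  proof (cases "p = []")
    case True
    then show ?thesis using A B by (simp add: nc_vorder_ge_1)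
  next
    case False
    then have len: "length p + length q = length w" "length p \<ge> 1"
      using that by (auto simp: Suc_le_eq)
    then have "nc_nth (prod_list (map (($) A) v)) q = nc_nth (prod_list (map (($) B) v)) q"
      using Cons by (intro Cons.IH) auto
    moreover have "nc_nth (prod_list (map (($) B) v)) q = 0" if "length p > n"
      using that len Cons.prems by (intro nc_nth_prod_list [OF B]) auto
    moreover have "nc_nth (A $ i) p = nc_nth (B $ i) p" if "length p \<le> n"
      using eq that by auto
    ultimately show ?thesis by (cases "length p \<le> n") auto
  qed
  then show ?case by (auto simp: nc_nth_times splits_def intro!: sum.cong)
qed simp

lemma nc_nth_subst_cong:
  fixes A B :: "('a :: comm_ring_1, 'n :: finite) nc_fps ^ 'n"
  assumes A: "1 \<le> nc_vorder A" and B: "1 \<le> nc_vorder B" and H: "2 \<le> nc_vorder H"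
    and eq: "\<And>i w. length w \<le> n \<Longrightarrow> nc_nth (A $ i) w = nc_nth (B $ i) w"
    and w: "length w \<le> Suc n"
  shows "nc_nth (nc_subst (H $ i) A) w = nc_nth (nc_subst (H $ i) B) w"
proof -
  have "nc_nth (H $ i) v * nc_nth (prod_list (map (($) A) v)) w
      = nc_nth (H $ i) v * nc_nth (prod_list (map (($) B) v)) w" for v
  proof (cases "length v < 2")
    case True
    then show ?thesis using H by (simp add: nc_vorder_ge_2)
  next
    case False
    then show ?thesis using w by (subst nc_nth_prod_list_cong [OF A B eq]) auto
  qed
  then show ?thesis by (simp add: nc_subst.rep_eq)
qed

lemma nc_right_inverse_ex:
  fixes H :: "('a :: comm_ring_1, 'n :: finite) nc_fps ^ 'n"
  assumes H: "2 \<le> nc_vorder H"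
  obtains G where "1 \<le> nc_vorder G" "nc_vsubst (nc_vars - H) G = nc_vars"
    "G = nc_vars + nc_vsubst H G"
proof -
  define K where "K = rec_nat nc_vars (\<lambda>_ X. nc_vars + nc_vsubst H X)"
  have K0: "K 0 = nc_vars" and KS: "K (Suc n) = nc_vars + nc_vsubst H (K n)" for n
    by (simp_all add: K_def)
  have H1: "1 \<le> nc_vorder H" using H by (simp add: nc_vorder_ge_1 nc_vorder_ge_2)
  have K1: "1 \<le> nc_vorder (K n)" for n
    using H1 nc_vorder_vars
    by (induction n) (auto simp: K0 KS nc_vorder_ge_1 nc_vsubst_def nc_nth_subst_Nil)
  have Kstep: "nc_nth (K (Suc n) $ i) w = nc_nth (K n $ i) w" if "length w \<le> n" for n i w
    using that
  proof (induction n arbitrary: i w)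
    case 0
    then show ?case using K1 by (auto simp: nc_vorder_ge_1)
  next
    case (Suc n)
    have "nc_nth (nc_subst (H $ i) (K (Suc n))) w = nc_nth (nc_subst (H $ i) (K n)) w"
      by (rule nc_nth_subst_cong [OF K1 K1 H Suc.IH Suc.prems])
    then show ?case by (simp add: KS [of "Suc n"] KS [of n] nc_vsubst_def)
  qed
  have Kle: "nc_nth (K m $ i) w = nc_nth (K n $ i) w" if "length w \<le> n" "n \<le> m" for m n i w
    using that(2,1) by (induction m rule: dec_induct) (auto simp: Kstep)
  define G where "G = (\<chi> i. Abs_nc_fps (\<lambda>w. nc_nth (K (length w) $ i) w))"
  have G: "nc_nth (G $ i) w = nc_nth (K (length w) $ i) w" for i w
    by (simp add: G_def Abs_nc_fps_inverse)
  have GK: "nc_nth (G $ i) w = nc_nth (K n $ i) w" if "length w \<le> n" for i w n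
    using Kle [of w "length w" n] that by (simp add: G)
  have G1: "1 \<le> nc_vorder G" using K1 by (simp add: nc_vorder_ge_1 G)
  have "G $ i = (nc_vars + nc_vsubst H G) $ i" for i
  proof (rule nc_fps_eqI)
    fix w
    have "nc_nth (G $ i) w = nc_nth (K (Suc (length w)) $ i) w" by (rule GK) simp
    also have "\<dots> = nc_nth ((nc_vars + nc_vsubst H (K (length w))) $ i) w" by (simp add: KS)
    also have "nc_nth (nc_subst (H $ i) (K (length w))) w = nc_nth (nc_subst (H $ i) G) w"
      by (rule nc_nth_subst_cong [OF K1 G1 H, of "length w"]) (simp_all add: GK)
    then have "nc_nth ((nc_vars + nc_vsubst H (K (length w))) $ i) w
        = nc_nth ((nc_vars + nc_vsubst H G) $ i) w"
      by (simp add: nc_vsubst_def)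
    finally show "nc_nth (G $ i) w = nc_nth ((nc_vars + nc_vsubst H G) $ i) w" .
  qed
  then have eq: "G = nc_vars + nc_vsubst H G" by (simp add: vec_eq_iff)
  moreover have "nc_vsubst (nc_vars - H) G = nc_vars"
    using eq by (simp add: nc_vsubst_diff nc_vars_vsubst [OF G1] algebra_simps)
  ultimately show thesis using that G1 by blast
qed

lemma nc_inverse_map_ex1:
  fixes H :: "('a :: comm_ring_1, 'n :: finite) nc_fps ^ 'n"
  assumes H: "2 \<le> nc_vorder H"
  defines "F \<equiv> nc_vars - H"
  shows "\<exists>!G. nc_vorder G \<ge> 1 \<and> nc_vsubst F G = nc_vars \<and> nc_vsubst G F = nc_vars"
proof -
  have F1: "1 \<le> nc_vorder F"
    using H nc_vorder_vars by (simp add: F_def nc_vorder_ge_1 nc_vorder_ge_2)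
  obtain G where G: "1 \<le> nc_vorder G" "nc_vsubst F G = nc_vars" "G = nc_vars + nc_vsubst H G"
    using nc_right_inverse_ex [OF H] unfolding F_def by metis
  have "2 \<le> nc_vorder (- nc_vsubst H G)"
  proof -
    have "nc_nth (nc_subst (H $ i) G) w = 0" if "length w < 2" for i w
    proof -
      have "nc_nth (H $ i) v = 0" if "length v \<le> length w" for v
        using H that \<open>length w < 2\<close> by (simp add: nc_vorder_ge_2)
      then show ?thesis by (simp add: nc_subst.rep_eq)
    qed
    then show ?thesis by (simp add: nc_vorder_ge_2 nc_vsubst_def)
  qed
  then obtain F' where F': "1 \<le> nc_vorder F'" "nc_vsubst (nc_vars - - nc_vsubst H G) F' = nc_vars"
    using nc_right_inverse_ex by metis
  then have GF': "nc_vsubst G F' = nc_vars" using G(3) by simp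
  have "F' = nc_vsubst (nc_vsubst F G) F'" by (simp add: G(2) nc_vars_vsubst [OF F'(1)])
  also have "\<dots> = F" by (simp add: nc_vsubst_assoc [OF G(1) F'(1)] GF')
  finally have GF: "nc_vsubst G F = nc_vars" using GF' by simp
  show ?thesis
  proof (rule ex1I [of _ G])
    fix G' assume G': "1 \<le> nc_vorder G' \<and> nc_vsubst F G' = nc_vars \<and> nc_vsubst G' F = nc_vars"
    then have "G' = nc_vsubst (nc_vsubst G F) G'" by (simp add: GF nc_vars_vsubst)
    also have "\<dots> = G" using G' by (simp add: nc_vsubst_assoc F1)
    finally show "G' = G" .
  qed (simp add: G(1,2) GF)
qed

lemma nc_inverse_map:
  assumes "2 \<le> nc_vorder H"
  shows "1 \<le> nc_vorder (nc_inverse_map (nc_vars - H))"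
    and "nc_vsubst (nc_vars - H) (nc_inverse_map (nc_vars - H)) = nc_vars"
    and "nc_vsubst (nc_inverse_map (nc_vars - H)) (nc_vars - H) = nc_vars"
  using theI' [OF nc_inverse_map_ex1 [OF assms]] by (simp_all add: nc_inverse_map_def)

end

(*
  If A and B are mutually inverse maps, the substitutions of A and of B are mutually inverse
  algebra automorphisms. Conjugating d/dt by them gives an additive derivation that differs from
  d/dt by a k[[t]]-linear derivation, which is determined by its values (dB_i/dt)(A) on the z_i:
    (d(U(B))/dt)(A) = dU/dt + [(dB/dt)(A) d/dz] U.
  So the differential equation for U says that d(U(B))/dt = 0, i.e. in characteristic 0 that
  U(B) is a series u over k, i.e. U = u(A). The two parts are the cases (A, B) = (F, G) and
  (A, B) = (G, F).
*)

theory Submission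
  imports Defs
begin

lemma nc_nth_dt [simp]: "nc_nth (nc_dt f) w = fps_deriv (nc_nth f w)"
  by (simp add: nc_dt_def nc_map.rep_eq)

lemma nc_nth_embed [simp]: "nc_nth (nc_embed u) w = fps_const (nc_nth u w)"
  by (simp add: nc_embed_def nc_map.rep_eq)

lemma nc_dt_add: "nc_dt (f + g) = nc_dt f + nc_dt g"
  by (rule nc_fps_eqI) simp

lemma nc_dt_diff: "nc_dt (f - g) = nc_dt f - nc_dt g"
  by (rule nc_fps_eqI) simp

lemma nc_dt_scale: "nc_dt (nc_scale c f) = nc_scale (fps_deriv c) f + nc_scale c (nc_dt f)"
  by (rule nc_fps_eqI) simp

lemma nc_dt_mult: "nc_dt (f * g) = nc_dt f * g + f * nc_dt g"
  by (rule nc_fps_eqI)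
     (simp add: nc_nth_times fps_deriv_sum case_prod_unfold sum.distrib algebra_simps)

lemma nc_dt_var [simp]: "nc_dt (nc_var i) = 0"
  by (rule nc_fps_eqI) simp

lemma nc_vdt_vars [simp]: "nc_vdt nc_vars = 0"
  by (simp add: nc_vdt_def nc_vars_def vec_eq_iff)

lemma nc_vdt_diff: "nc_vdt (U - V) = nc_vdt U - nc_vdt V"
  by (simp add: nc_vdt_def nc_dt_diff vec_eq_iff)

lemma nc_vsubst_0 [simp]: "nc_vsubst 0 A = 0"
  by (simp add: nc_vsubst_def vec_eq_iff)

text \<open>Coefficientwise: over an integral domain of characteristic 0, a power series in
  \<open>t\<close> with zero derivative equals its constant term. This is where the characteristic
  enters.\<close>

lemma nc_dt_eq_0_iff:
  fixes f :: "('a :: {idom, ring_char_0} fps, 'n) nc_fps"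
  shows "nc_dt f = 0 \<longleftrightarrow> (\<exists>u. f = nc_embed u)"
proof
  assume f: "nc_dt f = 0"
  have "f = nc_embed (nc_map (\<lambda>c. fps_nth c 0) f)"
  proof (rule nc_fps_eqI)
    fix w
    have "fps_deriv (nc_nth f w) = 0" using f nc_nth_dt [of f w] by simp
    then show "nc_nth f w = nc_nth (nc_embed (nc_map (\<lambda>c. fps_nth c 0) f)) w"
      by (simp add: fps_deriv_eq_0_iff nc_map.rep_eq)
  qed
  then show "\<exists>u. f = nc_embed u" ..
qed (auto intro: nc_fps_eqI)

text \<open>The negative of a derivation is a derivation, and a derivation is determined by its
  values on the variables.\<close>

lemma nc_vector_field_uminus:
  "nc_vector_field (- u) f = - nc_vector_field u f"
proof -
  have "nc_derivation (\<lambda>f. - nc_vector_field u f)"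
    using nc_vector_field(1) [of u] unfolding nc_derivation_def
    by (auto intro!: nc_fps_eqI)
  then have "nc_vector_field (- u) = (\<lambda>f. - nc_vector_field u f)"
    by (intro nc_derivation_unique) (simp_all add: nc_vector_field)
  then show ?thesis by simp
qed

lemma nc_subst_inverse:
  assumes "1 \<le> nc_vorder A" "1 \<le> nc_vorder B" "nc_vsubst A B = nc_vars"
  shows "nc_subst (nc_subst f A) B = f"
  using nc_subst_assoc [OF assms(1,2), of f] assms(3) by simp

lemma nc_dt_conjugate:
  fixes A B :: "('a :: comm_ring_1 fps, 'n :: finite) nc_fps ^ 'n"
  assumes A: "1 \<le> nc_vorder A" and B: "1 \<le> nc_vorder B" and BA: "nc_vsubst B A = nc_vars"
  shows "nc_subst (nc_dt (nc_subst f B)) A = nc_dt f + nc_vector_field (nc_vsubst (nc_vdt B) A) f"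
proof -
  define D where "D f = nc_subst (nc_dt (nc_subst f B)) A - nc_dt f" for f
  note inv = nc_subst_inverse [OF B A BA]
  have "nc_derivation D"
    unfolding nc_derivation_def
  proof (intro conjI allI)
    show "D (f + g) = D f + D g" for f g
      by (simp add: D_def nc_subst_add nc_dt_add)
    \<comment> \<open>Both terms of \<open>D\<close> contribute
      \<open>nc_scale (fps_deriv c) f\<close>, the first because substituting \<open>B\<close> and
      then \<open>A\<close> returns \<open>f\<close>; subtracting \<open>nc_dt\<close> cancels
      it.\<close>
    show "D (nc_scale c f) = nc_scale c (D f)" for c f
      by (rule nc_fps_eqI)
         (simp add: D_def nc_subst_scale nc_subst_add nc_dt_scale inv algebra_simps)
    show "D (f * g) = D f * g + f * D g" for f g
      by (simp add: D_def nc_subst_mult [OF A] nc_subst_mult [OF B] nc_subst_add nc_dt_mult inv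
          algebra_simps)
  qed
  \<comment> \<open>On \<open>nc_var i\<close> the term \<open>nc_dt\<close> vanishes and
    substituting \<open>B\<close> gives \<open>B $ i\<close>.\<close>
  then have "D = nc_vector_field (nc_vsubst (nc_vdt B) A)"
    by (rule nc_derivation_unique [OF _ nc_vector_field(1)])
       (simp add: D_def nc_subst_var [OF B] nc_vector_field nc_vsubst_def nc_vdt_def)
  then have "D f = nc_vector_field (nc_vsubst (nc_vdt B) A) f" by simp
  then show ?thesis by (simp add: D_def algebra_simps)
qed

lemma nc_subst_embed_iff:
  fixes A B :: "('a :: {idom, ring_char_0} fps, 'n :: finite) nc_fps ^ 'n"
  assumes A: "1 \<le> nc_vorder A" and B: "1 \<le> nc_vorder B"
    and AB: "nc_vsubst A B = nc_vars" and BA: "nc_vsubst B A = nc_vars"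
  shows "(\<exists>u. U = nc_subst (nc_embed u) A) \<longleftrightarrow>
    nc_dt U = - nc_vector_field (nc_vsubst (nc_vdt B) A) U"
proof -
  note inv = nc_subst_inverse [OF A B AB] nc_subst_inverse [OF B A BA]
  have "(\<exists>u. U = nc_subst (nc_embed u) A) \<longleftrightarrow> (\<exists>u. nc_subst U B = nc_embed u)"
    by (metis inv)
  also have "\<dots> \<longleftrightarrow> nc_dt (nc_subst U B) = 0"
    by (simp add: nc_dt_eq_0_iff)
  \<comment> \<open>Substitution of \<open>A\<close> is injective, since substitution of
    \<open>B\<close> undoes it.\<close>
  also have "\<dots> \<longleftrightarrow> nc_subst (nc_dt (nc_subst U B)) A = 0"
    by (metis inv(1) nc_subst_0)
  finally show ?thesis
    by (simp add: nc_dt_conjugate [OF A B BA] eq_neg_iff_add_eq_0)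
qed

theorem theorem3p4:
  fixes H F G M :: "('a :: {idom, ring_char_0} fps, 'n :: finite) nc_fps ^ 'n"
    and h m :: "('a fps, 'n) nc_fps \<Rightarrow> ('a fps, 'n) nc_fps"
  assumes "nc_vorder H \<ge> 2"
    and "F = nc_vars - H"
    and "G = nc_inverse_map F"
    and "M = G - nc_vars"
    and "h = nc_vector_field (nc_vsubst (nc_vdt M) F)"
    and "m = nc_vector_field (nc_vsubst (nc_vdt H) G)"
  shows "(\<forall>U. (\<exists>u :: ('a, 'n) nc_fps. U = nc_subst (nc_embed u) F) \<longleftrightarrow> nc_dt U = - h U) \<and>
    (\<forall>V. (\<exists>u :: ('a, 'n) nc_fps. V = nc_subst (nc_embed u) G) \<longleftrightarrow> nc_dt V = m V)"
proof -
  have F1: "1 \<le> nc_vorder F"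
    using assms(1,2) nc_vorder_vars by (simp add: nc_vorder_ge_1 nc_vorder_ge_2)
  have G1: "1 \<le> nc_vorder G" and FG: "nc_vsubst F G = nc_vars" and GF: "nc_vsubst G F = nc_vars"
    using nc_inverse_map [OF assms(1)] assms(2,3) by simp_all
  have "nc_vdt M = nc_vdt G"
    by (simp add: assms(4) nc_vdt_diff)
  \<comment> \<open>This sign, from \<open>F = nc_vars - H\<close>, cancels the minus in the general
    equation; hence \<open>+ m\<close> in the second part against \<open>- h\<close> in the
    first.\<close>
  moreover have "nc_vsubst (nc_vdt F) G = - nc_vsubst (nc_vdt H) G"
    using nc_vsubst_diff [of 0 "nc_vdt H" G] by (simp add: assms(2) nc_vdt_diff)
  ultimately show ?thesis
    using nc_subst_embed_iff [OF F1 G1 FG GF] nc_subst_embed_iff [OF G1 F1 GF FG]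
    by (simp add: assms(5,6) nc_vector_field_uminus)
qed

end
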